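(* Let $(L:\mathcal C\to\mathcal C,\ R:\mathcal C\to\mathcal C)$ be an adjoint pair ($L$ left adjoint to $R$) with $\mathbf L=(L,\Delta,\epsilon)$ a comonad and $\mathbf R=(R,\mu,\iota)$ the corresponding monad. Then: (1) $F^{\mathbf L}$ is heavily separable if and only if $F_{\mathbf R}$ is heavily separable. (2) For any adjunction $(P:\mathcal C\to\mathcal C,\ Q:\mathcal C\to\mathcal C)$ ($P$ left adjoint to $Q$) with associated comonad $\mathbf L=(L,\Delta,\epsilon)$ and associated monad $\mathbf R=(R,\mu,\iota)$, $Q$ is heavily separable if and only if $P$ is heavily separable.
   Context: Definition. A functor $F:\mathcal C\to\mathcal D$ is heavily separable if there is a natural transformation $P:\mathcal D(F(-),F(-))\to\mathcal C(-,-)$ of functors $\mathcal C^{op}\times\mathcal C\to \mathrm{Set}$ such that $P_{a,b}(F(f))=f$ for all $f\in\mathcal C(a,b)$, and $P_{a,c}(g\circ f)=P_{b,c}(g)\circ P_{a,b}(f)$ for all $f\in\mathcal D(Fa,Fb)$, $g\in\mathcal D(Fb,Fc)$. Corresponding monad: if $(F_1,G_1)$ and $(F_2,G_2)$ are adjoint pairs with units $\eta_i$ and counits $\varepsilon_i$, a natural transformation $\alpha:F_1\to F_2$ corresponds bijectively to $\overline\alpha:=G_1\varepsilon_2\circ G_1\alpha G_2\circ\eta_1G_2:G_2\to G_1$. Applied to $\Delta:L\to LL$ and $\epsilon:L\to1_{\mathcal C}$ (with the composite adjunction $(LL,RR)$ and the identity adjunction), this gives $\mu:=\overline\Delta:RR\to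 R$ and $\iota:=\overline\epsilon:1_{\mathcal C}\to R$; $\mathbf R=(R,\mu,\iota)$ is the monad corresponding to $\mathbf L$. For a monad $\mathbf R$ on $\mathcal C$, $F_{\mathbf R}:\mathcal C\to\mathcal C_{\mathbf R}$, $x\mapsto(Rx,\mu_x)$, is the free functor to the Eilenberg–Moore category of $\mathbf R$-algebras. For a comonad $\mathbf L$, $F^{\mathbf L}:\mathcal C\to\mathcal C^{\mathbf L}$, $x\mapsto(Lx,\Delta_x)$, is the (co)free functor to the Eilenberg–Moore category of $\mathbf L$-coalgebras. The monad associated to an adjunction $(F,G)$ with unit $\eta$, counit $\varepsilon$ is $(GF,G\varepsilon F,\eta)$; the associated comonad is $(FG,F\eta G,\varepsilon)$. *)

theory Defs
  imports Main
begin

section \<open>Categories, functors and natural transformations\<close>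

record ('o, 'm) category =
  Obj :: "'o set"
  Arr :: "'m set"
  Dom :: "'m \<Rightarrow> 'o"
  Cod :: "'m \<Rightarrow> 'o"
  Id :: "'o \<Rightarrow> 'm"
  Comp :: "'m \<Rightarrow> 'm \<Rightarrow> 'm"  (infixl "\<cdot>\<index>" 70)

definition hom :: "('o, 'm) category \<Rightarrow> 'o \<Rightarrow> 'o \<Rightarrow> 'm set" where
  "hom C a b = {f \<in> Arr C. Dom C f = a \<and> Cod C f = b}"

locale category =
  fixes C :: "('o, 'm) category" (structure)
  assumes Dom_in: "f \<in> Arr C \<Longrightarrow> Dom C f \<in> Obj C"
    and Cod_in: "f \<in> Arr C \<Longrightarrow> Cod C f \<in> Obj C"
    and Id_in: "a \<in> Obj C \<Longrightarrow> Id C a \<in> hom C a a"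
    and Comp_in: "\<lbrakk>f \<in> hom C a b; g \<in> hom C b c\<rbrakk> \<Longrightarrow> g \<cdot> f \<in> hom C a c"
    and Id_left: "f \<in> hom C a b \<Longrightarrow> Id C b \<cdot> f = f"
    and Id_right: "f \<in> hom C a b \<Longrightarrow> f \<cdot> Id C a = f"
    and assoc: "\<lbrakk>f \<in> hom C a b; g \<in> hom C b c; h \<in> hom C c d\<rbrakk>
      \<Longrightarrow> h \<cdot> (g \<cdot> f) = (h \<cdot> g) \<cdot> f"

record ('o1, 'm1, 'o2, 'm2) func =
  omap :: "'o1 \<Rightarrow> 'o2"
  amap :: "'m1 \<Rightarrow> 'm2"

locale cat_functor = dom: category C + cod: category D
  for C :: "('o1, 'm1) category" and D :: "('o2, 'm2) category" +
  fixes F :: "('o1, 'm1, 'o2, 'm2) func"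
  assumes omap_in: "a \<in> Obj C \<Longrightarrow> omap F a \<in> Obj D"
    and amap_in: "f \<in> hom C a b \<Longrightarrow> amap F f \<in> hom D (omap F a) (omap F b)"
    and amap_Id: "a \<in> Obj C \<Longrightarrow> amap F (Id C a) = Id D (omap F a)"
    and amap_Comp: "\<lbrakk>f \<in> hom C a b; g \<in> hom C b c\<rbrakk>
      \<Longrightarrow> amap F (g \<cdot>\<^bsub>C\<^esub> f) = amap F g \<cdot>\<^bsub>D\<^esub> amap F f"

definition id_func :: "('o, 'm, 'o, 'm) func" where
  "id_func = \<lparr>omap = (\<lambda>x. x), amap = (\<lambda>f. f)\<rparr>"

definition comp_func ::
  "('o2, 'm2, 'o3, 'm3) func \<Rightarrow> ('o1, 'm1, 'o2, 'm2) func \<Rightarrow> ('o1, 'm1, 'o3, 'm3) func"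
  (infixl "\<circ>\<^sub>F" 70) where
  "G \<circ>\<^sub>F F = \<lparr>omap = (\<lambda>x. omap G (omap F x)), amap = (\<lambda>f. amap G (amap F f))\<rparr>"

text \<open>Functors and natural transformations are represented by total functions, whose values
  off the carriers are irrelevant.  Equality of such data is therefore equality on the carriers.\<close>

definition func_eq ::
  "('o1, 'm1) category \<Rightarrow> ('o1, 'm1, 'o2, 'm2) func \<Rightarrow> ('o1, 'm1, 'o2, 'm2) func \<Rightarrow> bool" where
  "func_eq C F G \<longleftrightarrow>
    (\<forall>x\<in>Obj C. omap F x = omap G x) \<and> (\<forall>f\<in>Arr C. amap F f = amap G f)"

definition nat_eq :: "('o1, 'm1) category \<Rightarrow> ('o1 \<Rightarrow> 'm2) \<Rightarrow> ('o1 \<Rightarrow> 'm2) \<Rightarrow> bool" where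
  "nat_eq C \<sigma> \<tau> \<longleftrightarrow> (\<forall>x\<in>Obj C. \<sigma> x = \<tau> x)"

locale nat_trans = source: cat_functor C D F + target: cat_functor C D G
  for C :: "('o1, 'm1) category" and D :: "('o2, 'm2) category"
    and F G :: "('o1, 'm1, 'o2, 'm2) func" +
  fixes \<tau> :: "'o1 \<Rightarrow> 'm2"
  assumes component_in: "x \<in> Obj C \<Longrightarrow> \<tau> x \<in> hom D (omap F x) (omap G x)"
    and natural: "f \<in> hom C x y \<Longrightarrow> \<tau> y \<cdot>\<^bsub>D\<^esub> amap F f = amap G f \<cdot>\<^bsub>D\<^esub> \<tau> x"


section \<open>Heavily separable functors\<close>

text \<open>A natural transformation from \<open>D(F(-), F(-))\<close> to \<open>C(-, -)\<close>, as functors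
  from \<open>C\<^sup>o\<^sup>p \<times> C\<close> to sets, written out in components.\<close>

definition hom_nat_trans ::
  "('o1, 'm1) category \<Rightarrow> ('o2, 'm2) category \<Rightarrow> ('o1, 'm1, 'o2, 'm2) func
    \<Rightarrow> ('o1 \<Rightarrow> 'o1 \<Rightarrow> 'm2 \<Rightarrow> 'm1) \<Rightarrow> bool" where
  "hom_nat_trans C D F P \<longleftrightarrow>
    (\<forall>a\<in>Obj C. \<forall>b\<in>Obj C. \<forall>g\<in>hom D (omap F a) (omap F b). P a b g \<in> hom C a b) \<and>
    (\<forall>a\<in>Obj C. \<forall>b\<in>Obj C. \<forall>a'\<in>Obj C. \<forall>b'\<in>Obj C.
      \<forall>u\<in>hom C a' a. \<forall>v\<in>hom C b b'. \<forall>g\<in>hom D (omap F a) (omap F b).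
        P a' b' (amap F v \<cdot>\<^bsub>D\<^esub> g \<cdot>\<^bsub>D\<^esub> amap F u) = v \<cdot>\<^bsub>C\<^esub> P a b g \<cdot>\<^bsub>C\<^esub> u)"

definition heavily_separable ::
  "('o1, 'm1) category \<Rightarrow> ('o2, 'm2) category \<Rightarrow> ('o1, 'm1, 'o2, 'm2) func \<Rightarrow> bool" where
  "heavily_separable C D F \<longleftrightarrow> cat_functor C D F \<and>
    (\<exists>P. hom_nat_trans C D F P \<and>
      (\<forall>a\<in>Obj C. \<forall>b\<in>Obj C. \<forall>f\<in>hom C a b. P a b (amap F f) = f) \<and>
      (\<forall>a\<in>Obj C. \<forall>b\<in>Obj C. \<forall>c\<in>Obj C.
        \<forall>f\<in>hom D (omap F a) (omap F b). \<forall>g\<in>hom D (omap F b) (omap F c).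
          P a c (g \<cdot>\<^bsub>D\<^esub> f) = P b c g \<cdot>\<^bsub>C\<^esub> P a b f))"


section \<open>Adjunctions and mates\<close>

locale adjunction =
  unit: nat_trans C C id_func "G \<circ>\<^sub>F F" \<eta> + counit: nat_trans D D "F \<circ>\<^sub>F G" id_func \<epsilon> +
  left: cat_functor C D F + right: cat_functor D C G
  for C :: "('o1, 'm1) category" and D :: "('o2, 'm2) category"
    and F :: "('o1, 'm1, 'o2, 'm2) func" and G :: "('o2, 'm2, 'o1, 'm1) func"
    and \<eta> :: "'o1 \<Rightarrow> 'm1" and \<epsilon> :: "'o2 \<Rightarrow> 'm2" +
  assumes triangle_left: "x \<in> Obj C \<Longrightarrow> \<epsilon> (omap F x) \<cdot>\<^bsub>D\<^esub> amap F (\<eta> x) = Id D (omap F x)"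
    and triangle_right: "y \<in> Obj D \<Longrightarrow> amap G (\<epsilon> y) \<cdot>\<^bsub>C\<^esub> \<eta> (omap G y) = Id C (omap G y)"

text \<open>Counit of the composite of \<open>(F, G, \<eta>, \<epsilon>)\<close>, from \<open>C\<close> to \<open>D\<close>, with
  \<open>(F', G', \<eta>', \<epsilon>')\<close>, from \<open>D\<close> to \<open>E\<close>.\<close>

definition comp_counit ::
  "('o3, 'm3) category \<Rightarrow> ('o2, 'm2, 'o3, 'm3) func \<Rightarrow> ('o3, 'm3, 'o2, 'm2) func
    \<Rightarrow> ('o2 \<Rightarrow> 'm2) \<Rightarrow> ('o3 \<Rightarrow> 'm3) \<Rightarrow> 'o3 \<Rightarrow> 'm3" where
  "comp_counit E F' G' \<epsilon> \<epsilon>' = (\<lambda>z. \<epsilon>' z \<cdot>\<^bsub>E\<^esub> amap F' (\<epsilon> (omap G' z)))"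

text \<open>For adjunctions \<open>(F\<^sub>1, G\<^sub>1, \<eta>\<^sub>1, \<epsilon>\<^sub>1)\<close> and \<open>(F\<^sub>2, G\<^sub>2, \<eta>\<^sub>2, \<epsilon>\<^sub>2)\<close> from \<open>C\<close> to \<open>D\<close>, the
  transformation \<open>G\<^sub>2 \<rightarrow> G\<^sub>1\<close> corresponding to \<open>\<alpha> : F\<^sub>1 \<rightarrow> F\<^sub>2\<close>.  It involves only \<open>G\<^sub>1\<close>, \<open>\<eta>\<^sub>1\<close>,
  \<open>G\<^sub>2\<close> and \<open>\<epsilon>\<^sub>2\<close>.\<close>

definition mate ::
  "('o1, 'm1) category \<Rightarrow> ('o2, 'm2, 'o1, 'm1) func \<Rightarrow> ('o1 \<Rightarrow> 'm1)
    \<Rightarrow> ('o2, 'm2, 'o1, 'm1) func \<Rightarrow> ('o2 \<Rightarrow> 'm2) \<Rightarrow> ('o1 \<Rightarrow> 'm2) \<Rightarrow> 'o2 \<Rightarrow> 'm1" where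
  "mate C G\<^sub>1 \<eta>\<^sub>1 G\<^sub>2 \<epsilon>\<^sub>2 \<alpha> =
    (\<lambda>y. amap G\<^sub>1 (\<epsilon>\<^sub>2 y) \<cdot>\<^bsub>C\<^esub> amap G\<^sub>1 (\<alpha> (omap G\<^sub>2 y)) \<cdot>\<^bsub>C\<^esub> \<eta>\<^sub>1 (omap G\<^sub>2 y))"


section \<open>Monads and comonads\<close>

locale comonad =
  comult: nat_trans C C L "L \<circ>\<^sub>F L" \<Delta> + counit: nat_trans C C L id_func \<epsilon>
  for C :: "('o, 'm) category" and L :: "('o, 'm, 'o, 'm) func" and \<Delta> \<epsilon> :: "'o \<Rightarrow> 'm" +
  assumes coassoc: "x \<in> Obj C \<Longrightarrow>
      amap L (\<Delta> x) \<cdot>\<^bsub>C\<^esub> \<Delta> x = \<Delta> (omap L x) \<cdot>\<^bsub>C\<^esub> \<Delta> x"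
    and counit_left: "x \<in> Obj C \<Longrightarrow> \<epsilon> (omap L x) \<cdot>\<^bsub>C\<^esub> \<Delta> x = Id C (omap L x)"
    and counit_right: "x \<in> Obj C \<Longrightarrow> amap L (\<epsilon> x) \<cdot>\<^bsub>C\<^esub> \<Delta> x = Id C (omap L x)"

text \<open>\<open>(R, \<mu>, \<iota>)\<close> is the monad corresponding to the comonad \<open>(L, \<Delta>, \<epsilon>)\<close> under the adjunction
  of \<open>L\<close> and \<open>R\<close> with unit \<open>\<eta>\<close> and counit \<open>\<theta>\<close>: \<open>\<mu>\<close> is the mate of \<open>\<Delta>\<close> with respect to that
  adjunction and its composite with itself, and \<open>\<iota>\<close> is the mate of \<open>\<epsilon>\<close> with respect to that
  adjunction and the identity adjunction.  The monad laws are consequences and not part of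
  the definition.\<close>

definition corresponding_monad ::
  "('o, 'm) category \<Rightarrow> ('o, 'm, 'o, 'm) func \<Rightarrow> ('o, 'm, 'o, 'm) func
    \<Rightarrow> ('o \<Rightarrow> 'm) \<Rightarrow> ('o \<Rightarrow> 'm) \<Rightarrow> ('o \<Rightarrow> 'm) \<Rightarrow> ('o \<Rightarrow> 'm) \<Rightarrow> ('o \<Rightarrow> 'm) \<Rightarrow> ('o \<Rightarrow> 'm) \<Rightarrow> bool" where
  "corresponding_monad C L R \<eta> \<theta> \<Delta> \<epsilon> \<mu> \<iota> \<longleftrightarrow>
    nat_eq C \<mu> (mate C R \<eta> (R \<circ>\<^sub>F R) (comp_counit C L R \<theta> \<theta>) \<Delta>) \<and>
    nat_eq C \<iota> (mate C R \<eta> id_func (Id C) \<epsilon>)"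

definition associated_monad ::
  "('o1, 'm1) category \<Rightarrow> ('o1, 'm1, 'o2, 'm2) func \<Rightarrow> ('o2, 'm2, 'o1, 'm1) func
    \<Rightarrow> ('o1 \<Rightarrow> 'm1) \<Rightarrow> ('o2 \<Rightarrow> 'm2)
    \<Rightarrow> ('o1, 'm1, 'o1, 'm1) func \<Rightarrow> ('o1 \<Rightarrow> 'm1) \<Rightarrow> ('o1 \<Rightarrow> 'm1) \<Rightarrow> bool" where
  "associated_monad C F G \<eta> \<epsilon> R \<mu> \<iota> \<longleftrightarrow>
    func_eq C R (G \<circ>\<^sub>F F) \<and> nat_eq C \<mu> (\<lambda>x. amap G (\<epsilon> (omap F x))) \<and> nat_eq C \<iota> \<eta>"

definition associated_comonad ::
  "('o2, 'm2) category \<Rightarrow> ('o1, 'm1, 'o2, 'm2) func \<Rightarrow> ('o2, 'm2, 'o1, 'm1) func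
    \<Rightarrow> ('o1 \<Rightarrow> 'm1) \<Rightarrow> ('o2 \<Rightarrow> 'm2)
    \<Rightarrow> ('o2, 'm2, 'o2, 'm2) func \<Rightarrow> ('o2 \<Rightarrow> 'm2) \<Rightarrow> ('o2 \<Rightarrow> 'm2) \<Rightarrow> bool" where
  "associated_comonad D F G \<eta> \<epsilon> L \<Delta> \<epsilon>' \<longleftrightarrow>
    func_eq D L (F \<circ>\<^sub>F G) \<and> nat_eq D \<Delta> (\<lambda>y. amap F (\<eta> (omap G y))) \<and> nat_eq D \<epsilon>' \<epsilon>"


section \<open>Eilenberg--Moore categories\<close>

text \<open>A morphism is stored as a triple \<open>(A, f, B)\<close> with its source and target, since one
  underlying morphism \<open>f\<close> can be a morphism between several pairs of (co)algebras.\<close>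

type_synonym ('o, 'm) em_category = "('o \<times> 'm, ('o \<times> 'm) \<times> 'm \<times> ('o \<times> 'm)) category"

definition algebras ::
  "('o, 'm) category \<Rightarrow> ('o, 'm, 'o, 'm) func \<Rightarrow> ('o \<Rightarrow> 'm) \<Rightarrow> ('o \<Rightarrow> 'm) \<Rightarrow> ('o \<times> 'm) set" where
  "algebras C R \<mu> \<iota> = {(x, h). x \<in> Obj C \<and> h \<in> hom C (omap R x) x \<and>
    h \<cdot>\<^bsub>C\<^esub> \<iota> x = Id C x \<and> h \<cdot>\<^bsub>C\<^esub> \<mu> x = h \<cdot>\<^bsub>C\<^esub> amap R h}"

definition alg_category ::
  "('o, 'm) category \<Rightarrow> ('o, 'm, 'o, 'm) func \<Rightarrow> ('o \<Rightarrow> 'm) \<Rightarrow> ('o \<Rightarrow> 'm)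
    \<Rightarrow> ('o, 'm) em_category" where
  "alg_category C R \<mu> \<iota> =
    \<lparr>Obj = algebras C R \<mu> \<iota>,
     Arr = {((x, h), f, (y, k)) | x h f y k.
       (x, h) \<in> algebras C R \<mu> \<iota> \<and> (y, k) \<in> algebras C R \<mu> \<iota> \<and>
       f \<in> hom C x y \<and> f \<cdot>\<^bsub>C\<^esub> h = k \<cdot>\<^bsub>C\<^esub> amap R f},
     Dom = (\<lambda>(A, f, B). A),
     Cod = (\<lambda>(A, f, B). B),
     Id = (\<lambda>(x, h). ((x, h), Id C x, (x, h))),
     Comp = (\<lambda>(B, g, B') (A, f, A'). (A, g \<cdot>\<^bsub>C\<^esub> f, B'))\<rparr>"

definition free_func ::
  "('o, 'm) category \<Rightarrow> ('o, 'm, 'o, 'm) func \<Rightarrow> ('o \<Rightarrow> 'm)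
    \<Rightarrow> ('o, 'm, 'o \<times> 'm, ('o \<times> 'm) \<times> 'm \<times> ('o \<times> 'm)) func" where
  "free_func C R \<mu> =
    \<lparr>omap = (\<lambda>x. (omap R x, \<mu> x)),
     amap = (\<lambda>f. ((omap R (Dom C f), \<mu> (Dom C f)), amap R f, (omap R (Cod C f), \<mu> (Cod C f))))\<rparr>"

definition coalgebras ::
  "('o, 'm) category \<Rightarrow> ('o, 'm, 'o, 'm) func \<Rightarrow> ('o \<Rightarrow> 'm) \<Rightarrow> ('o \<Rightarrow> 'm) \<Rightarrow> ('o \<times> 'm) set" where
  "coalgebras C L \<Delta> \<epsilon> = {(x, h). x \<in> Obj C \<and> h \<in> hom C x (omap L x) \<and>
    \<epsilon> x \<cdot>\<^bsub>C\<^esub> h = Id C x \<and> \<Delta> x \<cdot>\<^bsub>C\<^esub> h = amap L h \<cdot>\<^bsub>C\<^esub> h}"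

definition coalg_category ::
  "('o, 'm) category \<Rightarrow> ('o, 'm, 'o, 'm) func \<Rightarrow> ('o \<Rightarrow> 'm) \<Rightarrow> ('o \<Rightarrow> 'm)
    \<Rightarrow> ('o, 'm) em_category" where
  "coalg_category C L \<Delta> \<epsilon> =
    \<lparr>Obj = coalgebras C L \<Delta> \<epsilon>,
     Arr = {((x, h), f, (y, k)) | x h f y k.
       (x, h) \<in> coalgebras C L \<Delta> \<epsilon> \<and> (y, k) \<in> coalgebras C L \<Delta> \<epsilon> \<and>
       f \<in> hom C x y \<and> k \<cdot>\<^bsub>C\<^esub> f = amap L f \<cdot>\<^bsub>C\<^esub> h},
     Dom = (\<lambda>(A, f, B). A),
     Cod = (\<lambda>(A, f, B). B),
     Id = (\<lambda>(x, h). ((x, h), Id C x, (x, h))),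
     Comp = (\<lambda>(B, g, B') (A, f, A'). (A, g \<cdot>\<^bsub>C\<^esub> f, B'))\<rparr>"

definition cofree_func ::
  "('o, 'm) category \<Rightarrow> ('o, 'm, 'o, 'm) func \<Rightarrow> ('o \<Rightarrow> 'm)
    \<Rightarrow> ('o, 'm, 'o \<times> 'm, ('o \<times> 'm) \<times> 'm \<times> ('o \<times> 'm)) func" where
  "cofree_func C L \<Delta> =
    \<lparr>omap = (\<lambda>x. (omap L x, \<Delta> x)),
     amap = (\<lambda>f. ((omap L (Dom C f), \<Delta> (Dom C f)), amap L f, (omap L (Cod C f), \<Delta> (Cod C f))))\<rparr>"

end

theory Submission
  imports Defs
begin

text \<open>Heavy separability of \<open>F\<close> depends only on the hom-sets \<open>D(Fa, Fb)\<close>, with their composition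
  and the action of \<open>F\<close>.  Between cofree coalgebras these are the coKleisli hom-sets \<open>C(La, b)\<close>,
  between free algebras the Kleisli hom-sets \<open>C(a, Rb)\<close>, and the adjunction bijection
  \<open>C(La, b) \<cong> C(a, Rb)\<close> respects both compositions because \<open>\<mu>\<close> and \<open>\<iota>\<close> are the mates of \<open>\<Delta>\<close>
  and \<open>\<epsilon>\<close>.  For an adjunction, the comparison functors identify the hom-sets
  of the left adjoint with those of the free functor, and of the right adjoint with those of
  the cofree functor, so the second part reduces to the first.\<close>

section \<open>Typing, associativity and naturality as rewrite rules\<close>

section \<open>Compositions of typed arrows\<close>

text \<open>Equations on \<open>Dom\<close> and \<open>Cod\<close> let the simplifier compute the
  ends of a composite; membership in \<open>hom\<close> would need the middle object guessed each
  time.\<close>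

lemma hom_iff: "f \<in> hom C a b \<longleftrightarrow> f \<in> Arr C \<and> Dom C f = a \<and> Cod C f = b"
  by (auto simp: hom_def)

lemma omap_comp_func [simp]: "omap (G \<circ>\<^sub>F F) x = omap G (omap F x)"
  and amap_comp_func [simp]: "amap (G \<circ>\<^sub>F F) f = amap G (amap F f)"
  and omap_id_func [simp]: "omap id_func x = x"
  and amap_id_func [simp]: "amap id_func f = f"
  by (simp_all add: comp_func_def id_func_def)

context category
begin

lemma Dom_Obj [simp]: "f \<in> Arr C \<Longrightarrow> Dom C f \<in> Obj C"
  and Cod_Obj [simp]: "f \<in> Arr C \<Longrightarrow> Cod C f \<in> Obj C"
  by (fact Dom_in, fact Cod_in)

lemma Id_Arr [simp]: "a \<in> Obj C \<Longrightarrow> Id C a \<in> Arr C"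
  and Dom_Id [simp]: "a \<in> Obj C \<Longrightarrow> Dom C (Id C a) = a"
  and Cod_Id [simp]: "a \<in> Obj C \<Longrightarrow> Cod C (Id C a) = a"
  using Id_in by (auto simp: hom_iff)

lemma Comp_Arr [simp]: "\<lbrakk>f \<in> Arr C; g \<in> Arr C; Cod C f = Dom C g\<rbrakk> \<Longrightarrow> g \<cdot> f \<in> Arr C"
  and Dom_Comp [simp]: "\<lbrakk>f \<in> Arr C; g \<in> Arr C; Cod C f = Dom C g\<rbrakk> \<Longrightarrow> Dom C (g \<cdot> f) = Dom C f"
  and Cod_Comp [simp]: "\<lbrakk>f \<in> Arr C; g \<in> Arr C; Cod C f = Dom C g\<rbrakk> \<Longrightarrow> Cod C (g \<cdot> f) = Cod C g"
  using Comp_in[of f _ _ g] by (auto simp: hom_iff)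

lemma Id_Comp [simp]: "\<lbrakk>f \<in> Arr C; Cod C f = b\<rbrakk> \<Longrightarrow> Id C b \<cdot> f = f"
  and Comp_Id [simp]: "\<lbrakk>f \<in> Arr C; Dom C f = a\<rbrakk> \<Longrightarrow> f \<cdot> Id C a = f"
  using Id_left Id_right by (auto simp: hom_iff)

text \<open>Together with \<open>amap_Comp'\<close> this fixes the normal form used throughout:
  right-nested composites, with functors pushed down to single arrows.\<close>

lemma Comp_assoc [simp]:
  "\<lbrakk>f \<in> Arr C; g \<in> Arr C; h \<in> Arr C; Cod C f = Dom C g; Cod C g = Dom C h\<rbrakk>
    \<Longrightarrow> (h \<cdot> g) \<cdot> f = h \<cdot> (g \<cdot> f)"
  using assoc[of f _ _ g _ h] by (auto simp: hom_iff)

text \<open>Lets an equation between composites rewrite the head of a longer right-nested composite.\<close>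

lemma Comp_reassoc:
  assumes "g \<cdot> f = k" "t \<in> Arr C" "f \<in> Arr C" "g \<in> Arr C" "Cod C t = Dom C f" "Cod C f = Dom C g"
  shows "g \<cdot> (f \<cdot> t) = k \<cdot> t"
  using assms Comp_assoc[of t f g] by simp

end

context cat_functor
begin

lemma omap_Obj [simp]: "a \<in> Obj C \<Longrightarrow> omap F a \<in> Obj D"
  by (fact omap_in)

lemma amap_Arr [simp]: "f \<in> Arr C \<Longrightarrow> amap F f \<in> Arr D"
  and Dom_amap [simp]: "f \<in> Arr C \<Longrightarrow> Dom D (amap F f) = omap F (Dom C f)"
  and Cod_amap [simp]: "f \<in> Arr C \<Longrightarrow> Cod D (amap F f) = omap F (Cod C f)"
  using amap_in[of f] by (auto simp: hom_iff)

declare amap_Id [simp]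

lemma amap_Comp' [simp]:
  "\<lbrakk>f \<in> Arr C; g \<in> Arr C; Cod C f = Dom C g\<rbrakk>
    \<Longrightarrow> amap F (g \<cdot>\<^bsub>C\<^esub> f) = amap F g \<cdot>\<^bsub>D\<^esub> amap F f"
  using amap_Comp[of f _ _ g] by (auto simp: hom_iff)

end

context nat_trans
begin

lemma component_Arr [simp]: "x \<in> Obj C \<Longrightarrow> \<tau> x \<in> Arr D"
  and Dom_component [simp]: "x \<in> Obj C \<Longrightarrow> Dom D (\<tau> x) = omap F x"
  and Cod_component [simp]: "x \<in> Obj C \<Longrightarrow> Cod D (\<tau> x) = omap G x"
  using component_in by (auto simp: hom_iff)

lemma naturality:
  "\<lbrakk>f \<in> Arr C; Dom C f = x; Cod C f = y\<rbrakk> \<Longrightarrow> \<tau> y \<cdot>\<^bsub>D\<^esub> amap F f = amap G f \<cdot>\<^bsub>D\<^esub> \<tau> x"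
  using natural by (auto simp: hom_iff)

text \<open>In right-nested form a naturality square is usually followed by a tail, here
  \<open>t\<close>.\<close>

lemma naturality_reassoc:
  "\<lbrakk>f \<in> Arr C; Dom C f = x; Cod C f = y; t \<in> Arr D; Cod D t = omap F x\<rbrakk>
    \<Longrightarrow> \<tau> y \<cdot>\<^bsub>D\<^esub> (amap F f \<cdot>\<^bsub>D\<^esub> t) = amap G f \<cdot>\<^bsub>D\<^esub> (\<tau> x \<cdot>\<^bsub>D\<^esub> t)"
  using source.cod.Comp_reassoc[OF naturality[of f x y], of t] by auto

end


section \<open>Pulling back splittings along maps of hom-sets\<close>

section \<open>Transfer of heavy separability\<close>

text \<open>\<open>\<Psi>\<close> acts as a functor from the full image of \<open>H\<close> to that
  of \<open>F\<close>, compatible with both functors out of \<open>C\<close>. Precomposing a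
  splitting of \<open>F\<close> with it gives a splitting of \<open>H\<close>.\<close>

lemma heavily_separable_pullback:
  assumes H: "cat_functor C E H"
    and \<Psi>_in: "\<And>a b h. \<lbrakk>a \<in> Obj C; b \<in> Obj C; h \<in> hom E (omap H a) (omap H b)\<rbrakk>
      \<Longrightarrow> \<Psi> a b h \<in> hom D (omap F a) (omap F b)"
    and \<Psi>_amap: "\<And>a b f. \<lbrakk>a \<in> Obj C; b \<in> Obj C; f \<in> hom C a b\<rbrakk> \<Longrightarrow> \<Psi> a b (amap H f) = amap F f"
    and \<Psi>_Comp: "\<And>a b c f g. \<lbrakk>a \<in> Obj C; b \<in> Obj C; c \<in> Obj C;
        f \<in> hom E (omap H a) (omap H b); g \<in> hom E (omap H b) (omap H c)\<rbrakk>
      \<Longrightarrow> \<Psi> a c (g \<cdot>\<^bsub>E\<^esub> f) = \<Psi> b c g \<cdot>\<^bsub>D\<^esub> \<Psi> a b f"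
    and sep: "heavily_separable C D F"
  shows "heavily_separable C E H"
proof -
  interpret H: cat_functor C E H by (fact H)
  from sep obtain P where P: "hom_nat_trans C D F P"
    "\<And>a b f. \<lbrakk>a \<in> Obj C; b \<in> Obj C; f \<in> hom C a b\<rbrakk> \<Longrightarrow> P a b (amap F f) = f"
    "\<And>a b c f g. \<lbrakk>a \<in> Obj C; b \<in> Obj C; c \<in> Obj C;
        f \<in> hom D (omap F a) (omap F b); g \<in> hom D (omap F b) (omap F c)\<rbrakk>
      \<Longrightarrow> P a c (g \<cdot>\<^bsub>D\<^esub> f) = P b c g \<cdot>\<^bsub>C\<^esub> P a b f"
    unfolding heavily_separable_def by blast
  define P' where "P' a b h = P a b (\<Psi> a b h)" for a b h
  have P'_in: "P' a b h \<in> hom C a b"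
    if "a \<in> Obj C" "b \<in> Obj C" "h \<in> hom E (omap H a) (omap H b)" for a b h
    using P(1) \<Psi>_in that unfolding hom_nat_trans_def P'_def by blast
  have P'_amap: "P' a b (amap H f) = f" if "a \<in> Obj C" "b \<in> Obj C" "f \<in> hom C a b" for a b f
    using that by (simp add: P'_def \<Psi>_amap P(2))
  have P'_Comp: "P' a c (g \<cdot>\<^bsub>E\<^esub> f) = P' b c g \<cdot>\<^bsub>C\<^esub> P' a b f"
    if "a \<in> Obj C" "b \<in> Obj C" "c \<in> Obj C"
      "f \<in> hom E (omap H a) (omap H b)" "g \<in> hom E (omap H b) (omap H c)" for a b c f g
    using that by (simp add: P'_def \<Psi>_Comp[of a b c] P(3)[of a b c] \<Psi>_in)
  \<comment> \<open>Naturality of \<open>P'\<close> follows from its algebraic laws: it is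
    multiplicative and returns \<open>u\<close> and \<open>v\<close> on \<open>amap H u\<close> and
    \<open>amap H v\<close>.\<close>
  have "P' a' b' (amap H v \<cdot>\<^bsub>E\<^esub> g \<cdot>\<^bsub>E\<^esub> amap H u) = v \<cdot>\<^bsub>C\<^esub> P' a b g \<cdot>\<^bsub>C\<^esub> u"
    if "a \<in> Obj C" "b \<in> Obj C" "a' \<in> Obj C" "b' \<in> Obj C" "u \<in> hom C a' a" "v \<in> hom C b b'"
      "g \<in> hom E (omap H a) (omap H b)" for a b a' b' u v g
  proof -
    have "P' a' b' (amap H v \<cdot>\<^bsub>E\<^esub> g \<cdot>\<^bsub>E\<^esub> amap H u) = P' a b' (amap H v \<cdot>\<^bsub>E\<^esub> g) \<cdot>\<^bsub>C\<^esub> P' a' a (amap H u)"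
      using that by (intro P'_Comp H.amap_in H.cod.Comp_in[of _ _ "omap H b"]) auto
    also have "P' a b' (amap H v \<cdot>\<^bsub>E\<^esub> g) = P' b b' (amap H v) \<cdot>\<^bsub>C\<^esub> P' a b g"
      using that by (intro P'_Comp H.amap_in) auto
    finally show ?thesis using that by (simp add: P'_amap)
  qed
  then show ?thesis
    unfolding heavily_separable_def hom_nat_trans_def
    using H P'_in P'_amap P'_Comp by (intro conjI exI[of _ P']) blast+
qed

text \<open>One direction is pullback along \<open>\<Psi>\<close>, the other pullback along its
  inverse, which inherits both compatibilities by injectivity.\<close>

lemma heavily_separable_transfer:
  assumes F: "cat_functor C D F" and H: "cat_functor C E H"
    and bij: "\<And>a b. \<lbrakk>a \<in> Obj C; b \<in> Obj C\<rbrakk>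
      \<Longrightarrow> bij_betw (\<Psi> a b) (hom E (omap H a) (omap H b)) (hom D (omap F a) (omap F b))"
    and \<Psi>_amap: "\<And>a b f. \<lbrakk>a \<in> Obj C; b \<in> Obj C; f \<in> hom C a b\<rbrakk> \<Longrightarrow> \<Psi> a b (amap H f) = amap F f"
    and \<Psi>_Comp: "\<And>a b c f g. \<lbrakk>a \<in> Obj C; b \<in> Obj C; c \<in> Obj C;
        f \<in> hom E (omap H a) (omap H b); g \<in> hom E (omap H b) (omap H c)\<rbrakk>
      \<Longrightarrow> \<Psi> a c (g \<cdot>\<^bsub>E\<^esub> f) = \<Psi> b c g \<cdot>\<^bsub>D\<^esub> \<Psi> a b f"
  shows "heavily_separable C D F \<longleftrightarrow> heavily_separable C E H"
proof
  assume sep: "heavily_separable C D F"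
  show "heavily_separable C E H"
  proof (rule heavily_separable_pullback[where \<Psi> = \<Psi>, OF H _ _ _ sep])
    show "\<Psi> a b h \<in> hom D (omap F a) (omap F b)"
      if "a \<in> Obj C" "b \<in> Obj C" "h \<in> hom E (omap H a) (omap H b)" for a b h
      using bij_betwE[OF bij[OF that(1,2)]] that(3) by blast
  qed (fact \<Psi>_amap \<Psi>_Comp)+
next
  interpret H: cat_functor C E H by (fact H)
  define \<Xi> where "\<Xi> a b = the_inv_into (hom E (omap H a) (omap H b)) (\<Psi> a b)" for a b
  have \<Xi>_in: "\<Xi> a b k \<in> hom E (omap H a) (omap H b)" and \<Psi>_\<Xi>: "\<Psi> a b (\<Xi> a b k) = k"
    if "a \<in> Obj C" "b \<in> Obj C" "k \<in> hom D (omap F a) (omap F b)" for a b k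
    using bij[of a b] that unfolding \<Xi>_def bij_betw_def
    by (auto intro: the_inv_into_into f_the_inv_into_f)
  \<comment> \<open>Reduces every equation about \<open>\<Xi>\<close> to one about
    \<open>\<Psi>\<close>, where the hypotheses apply.\<close>
  have \<Xi>_eq: "\<Xi> a b k = h"
    if "a \<in> Obj C" "b \<in> Obj C" "h \<in> hom E (omap H a) (omap H b)" "\<Psi> a b h = k" for a b h k
    using bij[of a b] that unfolding \<Xi>_def bij_betw_def by (auto intro: the_inv_into_f_eq)
  assume sep: "heavily_separable C E H"
  show "heavily_separable C D F"
  proof (rule heavily_separable_pullback[where \<Psi> = \<Xi>, OF F _ _ _ sep])
    fix a b c f g
    assume "a \<in> Obj C" "b \<in> Obj C" "c \<in> Obj C"
      "f \<in> hom D (omap F a) (omap F b)" "g \<in> hom D (omap F b) (omap F c)"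
    then show "\<Xi> a c (g \<cdot>\<^bsub>D\<^esub> f) = \<Xi> b c g \<cdot>\<^bsub>E\<^esub> \<Xi> a b f"
      by (intro \<Xi>_eq H.cod.Comp_in[of _ _ "omap H b"] \<Xi>_in)
        (simp_all add: \<Psi>_Comp[of a b c] \<Xi>_in \<Psi>_\<Xi>)
  qed (auto simp: \<Xi>_in intro!: \<Xi>_eq H.amap_in \<Psi>_amap)
qed


section \<open>Free algebras and cofree coalgebras\<close>

text \<open>The definitions of associated and corresponding monads do not contain the monad laws.
  Collecting them here allows the facts on free algebras to be proved once and inherited after the
  laws are derived.\<close>

locale monad =
  mult: nat_trans C C "R \<circ>\<^sub>F R" R \<mu> + unit: nat_trans C C id_func R \<iota> + endo: cat_functor C C R
  for C :: "('o, 'm) category" (structure)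
    and R :: "('o, 'm, 'o, 'm) func" and \<mu> \<iota> :: "'o \<Rightarrow> 'm" +
  assumes mult_assoc: "x \<in> Obj C \<Longrightarrow> \<mu> x \<cdot> \<mu> (omap R x) = \<mu> x \<cdot> amap R (\<mu> x)"
    and mult_unit_left: "x \<in> Obj C \<Longrightarrow> \<mu> x \<cdot> \<iota> (omap R x) = Id C (omap R x)"
    and mult_unit_right: "x \<in> Obj C \<Longrightarrow> \<mu> x \<cdot> amap R (\<iota> x) = Id C (omap R x)"

section \<open>Hom-sets and category laws of the Eilenberg-Moore categories\<close>

lemma hom_alg_category:
  "hom (alg_category C R \<mu> \<iota>) (x, h) (y, k) = {((x, h), f, (y, k)) | f.
     (x, h) \<in> algebras C R \<mu> \<iota> \<and> (y, k) \<in> algebras C R \<mu> \<iota> \<and> f \<in> hom C x y \<and>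
     f \<cdot>\<^bsub>C\<^esub> h = k \<cdot>\<^bsub>C\<^esub> amap R f}"
  unfolding hom_def alg_category_def by auto

lemma hom_coalg_category:
  "hom (coalg_category C L \<Delta> \<epsilon>) (x, h) (y, k) = {((x, h), f, (y, k)) | f.
     (x, h) \<in> coalgebras C L \<Delta> \<epsilon> \<and> (y, k) \<in> coalgebras C L \<Delta> \<epsilon> \<and> f \<in> hom C x y \<and>
     k \<cdot>\<^bsub>C\<^esub> f = amap L f \<cdot>\<^bsub>C\<^esub> h}"
  unfolding hom_def coalg_category_def by auto

lemma Comp_alg_category:
  "(B', g, B'') \<cdot>\<^bsub>alg_category C R \<mu> \<iota>\<^esub> (A, f, B) = (A, g \<cdot>\<^bsub>C\<^esub> f, B'')"
  by (simp add: alg_category_def)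

lemma Comp_coalg_category:
  "(B', g, B'') \<cdot>\<^bsub>coalg_category C L \<Delta> \<epsilon>\<^esub> (A, f, B) = (A, g \<cdot>\<^bsub>C\<^esub> f, B'')"
  by (simp add: coalg_category_def)

lemma Obj_alg_category: "Obj (alg_category C R \<mu> \<iota>) = algebras C R \<mu> \<iota>"
  and Id_alg_category: "Id (alg_category C R \<mu> \<iota>) (x, h) = ((x, h), Id C x, (x, h))"
  by (simp_all add: alg_category_def)

lemma Obj_coalg_category: "Obj (coalg_category C L \<Delta> \<epsilon>) = coalgebras C L \<Delta> \<epsilon>"
  and Id_coalg_category: "Id (coalg_category C L \<Delta> \<epsilon>) (x, h) = ((x, h), Id C x, (x, h))"
  by (simp_all add: coalg_category_def)

text \<open>Homomorphisms compose by pasting two squares and functoriality of \<open>R\<close>; the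
  remaining laws are those of \<open>C\<close> in the middle component of the triples.\<close>

lemma category_alg_category:
  assumes "cat_functor C C R"
  shows "category (alg_category C R \<mu> \<iota>)"
proof -
  interpret cat_functor C C R by (fact assms)
  note simps = hom_alg_category Comp_alg_category hom_iff[of _ C]
  \<comment> \<open>The square of the outer homomorphism \<open>g\<close> with a tail
    \<open>t\<close>, the shape left once the square of the inner one has been used.\<close>
  have reassoc: "g \<cdot>\<^bsub>C\<^esub> (k \<cdot>\<^bsub>C\<^esub> t) = (l \<cdot>\<^bsub>C\<^esub> amap R g) \<cdot>\<^bsub>C\<^esub> t"
    if "g \<cdot>\<^bsub>C\<^esub> k = l \<cdot>\<^bsub>C\<^esub> amap R g" "g \<in> Arr C" "k \<in> Arr C" "t \<in> Arr C"
      "Cod C t = Dom C k" "Cod C k = Dom C g" for g k l t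
    using dom.Comp_reassoc[OF that(1)] that by simp
  show ?thesis
    apply unfold_locales
    subgoal by (auto simp: alg_category_def)
    subgoal by (auto simp: alg_category_def)
    subgoal for a by (cases a) (auto simp: simps Obj_alg_category Id_alg_category algebras_def)
    subgoal for f a b g c by (cases a; cases b; cases c) (auto simp: simps algebras_def reassoc)
    subgoal for f a b by (cases a; cases b) (auto simp: simps Obj_alg_category Id_alg_category algebras_def)
    subgoal for f a b by (cases a; cases b) (auto simp: simps Obj_alg_category Id_alg_category algebras_def)
    subgoal for f a b g c h d
      by (cases a; cases b; cases c; cases d) (auto simp: simps algebras_def)
    done
qed

lemma category_coalg_category:
  assumes "cat_functor C C L"
  shows "category (coalg_category C L \<Delta> \<epsilon>)"
proof -
  interpret cat_functor C C L by (fact assms)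
  note simps = hom_coalg_category Comp_coalg_category hom_iff[of _ C]
  have reassoc: "k \<cdot>\<^bsub>C\<^esub> (g \<cdot>\<^bsub>C\<^esub> t) = (amap L g \<cdot>\<^bsub>C\<^esub> l) \<cdot>\<^bsub>C\<^esub> t"
    if "k \<cdot>\<^bsub>C\<^esub> g = amap L g \<cdot>\<^bsub>C\<^esub> l" "g \<in> Arr C" "k \<in> Arr C" "t \<in> Arr C"
      "Cod C t = Dom C g" "Cod C g = Dom C k" for g k l t
    using dom.Comp_reassoc[OF that(1)] that by simp
  show ?thesis
    apply unfold_locales
    subgoal by (auto simp: coalg_category_def)
    subgoal by (auto simp: coalg_category_def)
    subgoal for a by (cases a) (auto simp: simps Obj_coalg_category Id_coalg_category coalgebras_def)
    subgoal for f a b g c by (cases a; cases b; cases c) (auto simp: simps coalgebras_def reassoc)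
    subgoal for f a b by (cases a; cases b) (auto simp: simps Obj_coalg_category Id_coalg_category coalgebras_def)
    subgoal for f a b by (cases a; cases b) (auto simp: simps Obj_coalg_category Id_coalg_category coalgebras_def)
    subgoal for f a b g c h d
      by (cases a; cases b; cases c; cases d) (auto simp: simps coalgebras_def)
    done
qed

section \<open>The free and cofree functors\<close>

lemma (in monad) free_algebra: "x \<in> Obj C \<Longrightarrow> (omap R x, \<mu> x) \<in> algebras C R \<mu> \<iota>"
  by (simp add: algebras_def hom_iff mult_unit_left mult_assoc)

lemma (in comonad) cofree_coalgebra: "x \<in> Obj C \<Longrightarrow> (omap L x, \<Delta> x) \<in> coalgebras C L \<Delta> \<epsilon>"
  by (simp add: coalgebras_def hom_iff counit_left coassoc)

text \<open>Naturality of \<mu> is what makes \<open>amap R f\<close> a homomorphism of free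
  algebras.\<close>

lemma (in monad) cat_functor_free_func: "cat_functor C (alg_category C R \<mu> \<iota>) (free_func C R \<mu>)"
proof -
  interpret A: category "alg_category C R \<mu> \<iota>"
    by (rule category_alg_category) (fact mult.target.cat_functor_axioms)
  note simps = hom_alg_category Comp_alg_category hom_iff[of _ C] free_func_def free_algebra
  show ?thesis
    apply unfold_locales
    subgoal by (simp add: free_func_def alg_category_def free_algebra)
    subgoal using mult.naturality by (auto simp: simps)
    subgoal by (simp add: free_func_def alg_category_def)
    subgoal by (auto simp: simps)
    done
qed

lemma (in comonad) cat_functor_cofree_func:
  "cat_functor C (coalg_category C L \<Delta> \<epsilon>) (cofree_func C L \<Delta>)"
proof -
  interpret A: category "coalg_category C L \<Delta> \<epsilon>"
    by (rule category_coalg_category) (fact comult.source.cat_functor_axioms)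
  note simps = hom_coalg_category Comp_coalg_category hom_iff[of _ C] cofree_func_def cofree_coalgebra
  show ?thesis
    apply unfold_locales
    subgoal by (simp add: cofree_func_def coalg_category_def cofree_coalgebra)
    subgoal using comult.naturality by (auto simp: simps)
    subgoal by (simp add: cofree_func_def coalg_category_def)
    subgoal by (auto simp: simps)
    done
qed


section \<open>Comparison functors of an adjunction\<close>

section \<open>Adjunctions and their associated monads and comonads\<close>

context adjunction
begin

text \<open>Transposing \<open>f\<close> to D and back is the identity, by naturality of \<eta> and
  a triangle identity. The left side is already in normal form.\<close>

lemma counit_transpose:
  assumes "b \<in> Obj D" "f \<in> Arr C" "Dom C f = a" "Cod C f = omap G b"
  shows "amap G (\<epsilon> b) \<cdot>\<^bsub>C\<^esub> (amap G (amap F f) \<cdot>\<^bsub>C\<^esub> \<eta> a) = f"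
  using assms unit.naturality[of f a "omap G b"]
    unit.source.dom.Comp_reassoc[OF triangle_right[of b], of f] by auto

lemma unit_transpose:
  assumes "a \<in> Obj C" "g \<in> Arr D" "Dom D g = omap F a" "Cod D g = b"
  shows "\<epsilon> b \<cdot>\<^bsub>D\<^esub> (amap F (amap G g) \<cdot>\<^bsub>D\<^esub> amap F (\<eta> a)) = g"
  using assms counit.naturality_reassoc[of g "omap F a" b "amap F (\<eta> a)"]
  by (auto simp: triangle_left)

text \<open>The comparison functor to algebras is fully faithful between objects in the image of
  \<open>F\<close>, and it carries \<open>F\<close> to the free functor.\<close>

lemma heavily_separable_left_iff_free_func:
  assumes "monad C R \<mu> \<iota>" and assoc: "associated_monad C F G \<eta> \<epsilon> R \<mu> \<iota>"
  shows "heavily_separable C D F \<longleftrightarrow>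
    heavily_separable C (alg_category C R \<mu> \<iota>) (free_func C R \<mu>)"
proof -
  interpret M: monad C R \<mu> \<iota> by (fact assms)
  have eqs: "\<And>x. x \<in> Obj C \<Longrightarrow> omap R x = omap G (omap F x)"
    "\<And>f. f \<in> Arr C \<Longrightarrow> amap R f = amap G (amap F f)"
    "\<And>x. x \<in> Obj C \<Longrightarrow> \<mu> x = amap G (\<epsilon> (omap F x))"
    using assoc by (auto simp: associated_monad_def func_eq_def nat_eq_def)
  \<comment> \<open>The comparison functor on arrows; its labels use \<open>R\<close> and
    \<open>\<mu>\<close> so that they agree literally with those of
    \<open>free_func\<close>.\<close>
  define \<Psi> where "\<Psi> a b k = ((omap R a, \<mu> a), amap G k, (omap R b, \<mu> b))" for a b k
  note simps = hom_alg_category Comp_alg_category hom_iff[of _ C] hom_iff[of _ D] \<Psi>_def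
    free_func_def
  have bij: "bij_betw (\<Psi> a b) (hom D (omap F a) (omap F b))
      (hom (alg_category C R \<mu> \<iota>) (omap (free_func C R \<mu>) a) (omap (free_func C R \<mu>) b))"
    if ab: "a \<in> Obj C" "b \<in> Obj C" for a b
  \<comment> \<open>The inverse restricts a homomorphism along \<eta> and transposes the
    result.\<close>
  proof (rule bij_betw_byWitness[where f' =
        "\<lambda>(A, h, B). \<epsilon> (omap F b) \<cdot>\<^bsub>D\<^esub> amap F (h \<cdot>\<^bsub>C\<^esub> \<eta> a)"])
    show "\<forall>k\<in>hom D (omap F a) (omap F b).
        (case \<Psi> a b k of (A, h, B) \<Rightarrow> \<epsilon> (omap F b) \<cdot>\<^bsub>D\<^esub> amap F (h \<cdot>\<^bsub>C\<^esub> \<eta> a)) = k"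
      using ab by (auto simp: simps unit_transpose)
    \<comment> \<open>The homomorphism equation moves \<open>h\<close> in front of
      \<open>\<mu> a\<close>; a triangle identity cancels what remains.\<close>
    have *: "amap G (\<epsilon> (omap F b)) \<cdot>\<^bsub>C\<^esub> (amap G (amap F h) \<cdot>\<^bsub>C\<^esub> amap G (amap F (\<eta> a))) = h"
      if "h \<in> Arr C" "Dom C h = omap R a" "Cod C h = omap R b" "h \<cdot>\<^bsub>C\<^esub> \<mu> a = \<mu> b \<cdot>\<^bsub>C\<^esub> amap R h" for h
    proof -
      have "amap G (\<epsilon> (omap F b)) \<cdot>\<^bsub>C\<^esub> (amap G (amap F h) \<cdot>\<^bsub>C\<^esub> amap G (amap F (\<eta> a)))
          = (\<mu> b \<cdot>\<^bsub>C\<^esub> amap R h) \<cdot>\<^bsub>C\<^esub> amap G (amap F (\<eta> a))"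
        using that ab by (simp add: eqs)
      also have "\<dots> = h \<cdot>\<^bsub>C\<^esub> amap G (\<epsilon> (omap F a) \<cdot>\<^bsub>D\<^esub> amap F (\<eta> a))"
        using that(1-3) ab unfolding that(4)[symmetric] by (simp add: eqs)
      finally show ?thesis using that ab by (simp add: triangle_left eqs)
    qed
    show "\<forall>h\<in>hom (alg_category C R \<mu> \<iota>) (omap (free_func C R \<mu>) a) (omap (free_func C R \<mu>) b).
        \<Psi> a b (case h of (A, h, B) \<Rightarrow> \<epsilon> (omap F b) \<cdot>\<^bsub>D\<^esub> amap F (h \<cdot>\<^bsub>C\<^esub> \<eta> a)) = h"
      using ab * by (auto simp: simps eqs(1))
    show "\<Psi> a b ` hom D (omap F a) (omap F b) \<subseteq>
        hom (alg_category C R \<mu> \<iota>) (omap (free_func C R \<mu>) a) (omap (free_func C R \<mu>) b)"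
    proof -
      \<comment> \<open>This is the image under \<open>G\<close> of naturality of \<epsilon> at
        \<open>k\<close>.\<close>
      have "amap G k \<cdot>\<^bsub>C\<^esub> \<mu> a = \<mu> b \<cdot>\<^bsub>C\<^esub> amap R (amap G k)"
        if "k \<in> Arr D" "Dom D k = omap F a" "Cod D k = omap F b" for k
        using that ab arg_cong[OF counit.naturality[of k "omap F a" "omap F b"], of "amap G"]
        by (simp add: eqs)
      then show ?thesis using ab by (auto simp: simps M.free_algebra) (simp_all add: eqs)
    qed
    show "(\<lambda>(A, h, B). \<epsilon> (omap F b) \<cdot>\<^bsub>D\<^esub> amap F (h \<cdot>\<^bsub>C\<^esub> \<eta> a)) `
        hom (alg_category C R \<mu> \<iota>) (omap (free_func C R \<mu>) a) (omap (free_func C R \<mu>) b)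
        \<subseteq> hom D (omap F a) (omap F b)"
      using ab by (auto simp: simps eqs(1))
  qed
  show ?thesis
  proof (rule heavily_separable_transfer[where \<Psi> = \<Psi>, symmetric])
    show "cat_functor C (alg_category C R \<mu> \<iota>) (free_func C R \<mu>)"
      by (fact M.cat_functor_free_func)
    show "cat_functor C D F"
      by (fact left.cat_functor_axioms)
    show "bij_betw (\<Psi> a b) (hom D (omap F a) (omap F b))
        (hom (alg_category C R \<mu> \<iota>) (omap (free_func C R \<mu>) a) (omap (free_func C R \<mu>) b))"
      if "a \<in> Obj C" "b \<in> Obj C" for a b
      using that by (fact bij)
    show "\<Psi> a b (amap F f) = amap (free_func C R \<mu>) f" if "f \<in> hom C a b" for a b f
      using that by (auto simp: simps eqs(2))
    show "\<Psi> a c (g \<cdot>\<^bsub>D\<^esub> f) = \<Psi> b c g \<cdot>\<^bsub>alg_category C R \<mu> \<iota>\<^esub> \<Psi> a b f"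
      if "f \<in> hom D (omap F a) (omap F b)" "g \<in> hom D (omap F b) (omap F c)" for a b c f g
      using that by (auto simp: simps)
  qed
qed

text \<open>Dually, the comparison functor to coalgebras is fully faithful between objects in the
  image of \<open>G\<close>, and it carries \<open>G\<close> to the cofree functor.\<close>

lemma heavily_separable_right_iff_cofree_func:
  assumes "comonad D L \<Delta> \<epsilon>'" and assoc: "associated_comonad D F G \<eta> \<epsilon> L \<Delta> \<epsilon>'"
  shows "heavily_separable D C G \<longleftrightarrow>
    heavily_separable D (coalg_category D L \<Delta> \<epsilon>') (cofree_func D L \<Delta>)"
proof -
  interpret M: comonad D L \<Delta> \<epsilon>' by (fact assms)
  have eqs: "\<And>x. x \<in> Obj D \<Longrightarrow> omap L x = omap F (omap G x)"
    "\<And>f. f \<in> Arr D \<Longrightarrow> amap L f = amap F (amap G f)"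
    "\<And>x. x \<in> Obj D \<Longrightarrow> \<Delta> x = amap F (\<eta> (omap G x))"
    using assoc by (auto simp: associated_comonad_def func_eq_def nat_eq_def)
  define \<Psi> where "\<Psi> a b k = ((omap L a, \<Delta> a), amap F k, (omap L b, \<Delta> b))" for a b k
  note simps = hom_coalg_category Comp_coalg_category hom_iff[of _ C] hom_iff[of _ D] \<Psi>_def
    cofree_func_def
  have bij: "bij_betw (\<Psi> a b) (hom C (omap G a) (omap G b))
      (hom (coalg_category D L \<Delta> \<epsilon>') (omap (cofree_func D L \<Delta>) a) (omap (cofree_func D L \<Delta>) b))"
    if ab: "a \<in> Obj D" "b \<in> Obj D" for a b
  \<comment> \<open>The inverse composes a homomorphism with \<epsilon> and transposes the
    result.\<close>
  proof (rule bij_betw_byWitness[where f' =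
        "\<lambda>(A, h, B). amap G (\<epsilon> b \<cdot>\<^bsub>D\<^esub> h) \<cdot>\<^bsub>C\<^esub> \<eta> (omap G a)"])
    show "\<forall>k\<in>hom C (omap G a) (omap G b).
        (case \<Psi> a b k of (A, h, B) \<Rightarrow> amap G (\<epsilon> b \<cdot>\<^bsub>D\<^esub> h) \<cdot>\<^bsub>C\<^esub> \<eta> (omap G a)) = k"
      using ab by (auto simp: simps counit_transpose)
    have *: "amap F (amap G (\<epsilon> b)) \<cdot>\<^bsub>D\<^esub> (amap F (amap G h) \<cdot>\<^bsub>D\<^esub> amap F (\<eta> (omap G a))) = h"
      if "h \<in> Arr D" "Dom D h = omap L a" "Cod D h = omap L b" "\<Delta> b \<cdot>\<^bsub>D\<^esub> h = amap L h \<cdot>\<^bsub>D\<^esub> \<Delta> a" for h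
    proof -
      have "amap F (amap G (\<epsilon> b)) \<cdot>\<^bsub>D\<^esub> (amap F (amap G h) \<cdot>\<^bsub>D\<^esub> amap F (\<eta> (omap G a)))
          = amap F (amap G (\<epsilon> b)) \<cdot>\<^bsub>D\<^esub> (\<Delta> b \<cdot>\<^bsub>D\<^esub> h)"
        using that ab by (simp add: eqs)
      also have "\<dots> = amap F (amap G (\<epsilon> b) \<cdot>\<^bsub>C\<^esub> \<eta> (omap G b)) \<cdot>\<^bsub>D\<^esub> h"
        using that(1-3) ab by (simp add: eqs)
      finally show ?thesis using that ab by (simp add: triangle_right eqs)
    qed
    show "\<forall>h\<in>hom (coalg_category D L \<Delta> \<epsilon>') (omap (cofree_func D L \<Delta>) a) (omap (cofree_func D L \<Delta>) b).
        \<Psi> a b (case h of (A, h, B) \<Rightarrow> amap G (\<epsilon> b \<cdot>\<^bsub>D\<^esub> h) \<cdot>\<^bsub>C\<^esub> \<eta> (omap G a)) = h"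
      using ab * by (auto simp: simps eqs(1))
    show "\<Psi> a b ` hom C (omap G a) (omap G b) \<subseteq>
        hom (coalg_category D L \<Delta> \<epsilon>') (omap (cofree_func D L \<Delta>) a) (omap (cofree_func D L \<Delta>) b)"
    proof -
      \<comment> \<open>This is the image under \<open>F\<close> of naturality of \<eta> at
        \<open>k\<close>.\<close>
      have "\<Delta> b \<cdot>\<^bsub>D\<^esub> amap F k = amap L (amap F k) \<cdot>\<^bsub>D\<^esub> \<Delta> a"
        if "k \<in> Arr C" "Dom C k = omap G a" "Cod C k = omap G b" for k
        using that ab arg_cong[OF unit.naturality[of k "omap G a" "omap G b"], of "amap F"]
        by (simp add: eqs)
      then show ?thesis using ab by (auto simp: simps M.cofree_coalgebra) (simp_all add: eqs)
    qed
    show "(\<lambda>(A, h, B). amap G (\<epsilon> b \<cdot>\<^bsub>D\<^esub> h) \<cdot>\<^bsub>C\<^esub> \<eta> (omap G a)) `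
        hom (coalg_category D L \<Delta> \<epsilon>') (omap (cofree_func D L \<Delta>) a) (omap (cofree_func D L \<Delta>) b)
        \<subseteq> hom C (omap G a) (omap G b)"
      using ab by (auto simp: simps eqs(1))
  qed
  show ?thesis
  proof (rule heavily_separable_transfer[where \<Psi> = \<Psi>, symmetric])
    show "cat_functor D (coalg_category D L \<Delta> \<epsilon>') (cofree_func D L \<Delta>)"
      by (fact M.cat_functor_cofree_func)
    show "cat_functor D C G"
      by (fact right.cat_functor_axioms)
    show "bij_betw (\<Psi> a b) (hom C (omap G a) (omap G b))
        (hom (coalg_category D L \<Delta> \<epsilon>') (omap (cofree_func D L \<Delta>) a) (omap (cofree_func D L \<Delta>) b))"
      if "a \<in> Obj D" "b \<in> Obj D" for a b
      using that by (fact bij)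
    show "\<Psi> a b (amap G f) = amap (cofree_func D L \<Delta>) f" if "f \<in> hom D a b" for a b f
      using that by (auto simp: simps eqs(2))
    show "\<Psi> a c (g \<cdot>\<^bsub>C\<^esub> f) = \<Psi> b c g \<cdot>\<^bsub>coalg_category D L \<Delta> \<epsilon>'\<^esub> \<Psi> a b f"
      if "f \<in> hom C (omap G a) (omap G b)" "g \<in> hom C (omap G b) (omap G c)" for a b c f g
      using that by (auto simp: simps)
  qed
qed

end


section \<open>Kleisli extension\<close>

section \<open>Kleisli representation of homomorphisms between free algebras\<close>

context monad
begin

text \<open>The Kleisli extension of an arrow \<open>p\<close> from \<open>a\<close> to
  \<open>R b\<close>, labelled as an arrow of the algebra category.\<close>

definition extend :: "'o \<Rightarrow> 'm \<Rightarrow> 'o \<Rightarrow> ('o \<times> 'm) \<times> 'm \<times> ('o \<times> 'm)" where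
  "extend a p b = ((omap R a, \<mu> a), \<mu> b \<cdot> amap R p, (omap R b, \<mu> b))"

lemma extend_in:
  assumes "a \<in> Obj C" "b \<in> Obj C" "p \<in> hom C a (omap R b)"
  shows "extend a p b \<in> hom (alg_category C R \<mu> \<iota>) (omap R a, \<mu> a) (omap R b, \<mu> b)"
proof -
  have "\<mu> b \<cdot> (amap R p \<cdot> \<mu> a) = (\<mu> b \<cdot> \<mu> (omap R b)) \<cdot> amap R (amap R p)"
    using assms mult.naturality[of p a "omap R b"] by (simp add: hom_iff)
  also have "\<dots> = \<mu> b \<cdot> (amap R (\<mu> b) \<cdot> amap R (amap R p))"
    using assms unfolding mult_assoc[OF assms(2)] by (simp add: hom_iff)
  finally show ?thesis
    using assms by (simp add: extend_def hom_alg_category hom_iff[of _ C] free_algebra)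
qed

lemma extend_unit:
  assumes "a \<in> Obj C" "b \<in> Obj C" "p \<in> hom C a (omap R b)"
  shows "(\<mu> b \<cdot> amap R p) \<cdot> \<iota> a = p"
proof -
  have "(\<mu> b \<cdot> amap R p) \<cdot> \<iota> a = (\<mu> b \<cdot> \<iota> (omap R b)) \<cdot> p"
    using assms unit.naturality[of p a "omap R b"] by (simp add: hom_iff)
  then show ?thesis
    using assms by (simp add: mult_unit_left hom_iff)
qed

text \<open>The homomorphism equation and the right unit law show that a homomorphism is determined
  by its restriction along \<iota>. With \<open>extend_unit\<close> this makes extension a
  bijection.\<close>

lemma extend_restrict:
  assumes "a \<in> Obj C" "b \<in> Obj C"
    and "(A, k, B) \<in> hom (alg_category C R \<mu> \<iota>) (omap R a, \<mu> a) (omap R b, \<mu> b)"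
  shows "extend a (k \<cdot> \<iota> a) b = (A, k, B)"
proof -
  have k: "k \<in> Arr C" "Dom C k = omap R a" "Cod C k = omap R b" "k \<cdot> \<mu> a = \<mu> b \<cdot> amap R k"
    and AB: "A = (omap R a, \<mu> a)" "B = (omap R b, \<mu> b)"
    using assms(3) by (simp_all add: hom_alg_category hom_iff[of _ C])
  have "\<mu> b \<cdot> amap R (k \<cdot> \<iota> a) = (\<mu> b \<cdot> amap R k) \<cdot> amap R (\<iota> a)"
    using assms(1,2) k(1-3) by simp
  also have "\<dots> = k \<cdot> (\<mu> a \<cdot> amap R (\<iota> a))"
    using assms(1,2) k(1-3) unfolding k(4)[symmetric] by simp
  finally show ?thesis
    using assms(1,2) k by (simp add: extend_def mult_unit_right AB)
qed

text \<open>The argument on the left is the Kleisli composite of \<open>q\<close> and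
  \<open>p\<close>; associativity and naturality of \<mu> turn its extension into a composite of
  extensions.\<close>

lemma extend_Comp:
  assumes "a \<in> Obj C" "b \<in> Obj C" "c \<in> Obj C" "p \<in> hom C a (omap R b)" "q \<in> hom C b (omap R c)"
  shows "extend a (\<mu> c \<cdot> (amap R q \<cdot> p)) c
    = extend b q c \<cdot>\<^bsub>alg_category C R \<mu> \<iota>\<^esub> extend a p b"
proof -
  have "\<mu> c \<cdot> (amap R (\<mu> c) \<cdot> (amap R (amap R q) \<cdot> amap R p))
      = (\<mu> c \<cdot> amap R (\<mu> c)) \<cdot> (amap R (amap R q) \<cdot> amap R p)"
    using assms by (simp add: hom_iff)
  also have "\<dots> = \<mu> c \<cdot> (amap R q \<cdot> (\<mu> b \<cdot> amap R p))"
    unfolding mult_assoc[OF assms(3), symmetric]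
    using assms mult.naturality_reassoc[of q b "omap R c" "amap R p"] by (simp add: hom_iff)
  finally show ?thesis
    using assms by (simp add: extend_def Comp_alg_category hom_iff)
qed

lemma extend_amap:
  assumes "f \<in> hom C a b"
  shows "extend a (amap R f \<cdot> \<iota> a) b = amap (free_func C R \<mu>) f"
proof -
  have "\<mu> b \<cdot> amap R (amap R f \<cdot> \<iota> a) = amap R f \<cdot> (\<mu> a \<cdot> amap R (\<iota> a))"
    using assms mult.naturality_reassoc[of f a b "amap R (\<iota> a)"] by (auto simp: hom_iff)
  then show ?thesis
    using assms by (auto simp: extend_def free_func_def mult_unit_right hom_iff)
qed

end

section \<open>CoKleisli extension to homomorphisms of cofree coalgebras\<close>

context comonad
begin

definition coextend :: "'o \<Rightarrow> 'm \<Rightarrow> 'o \<Rightarrow> ('o \<times> 'm) \<times> 'm \<times> ('o \<times> 'm)" where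
  "coextend a f b = ((omap L a, \<Delta> a), amap L f \<cdot>\<^bsub>C\<^esub> \<Delta> a, (omap L b, \<Delta> b))"

lemma coextend_in:
  assumes "a \<in> Obj C" "b \<in> Obj C" "f \<in> hom C (omap L a) b"
  shows "coextend a f b \<in> hom (coalg_category C L \<Delta> \<epsilon>) (omap L a, \<Delta> a) (omap L b, \<Delta> b)"
  using assms comult.naturality_reassoc[of f "omap L a" b "\<Delta> a"]
  by (simp add: coextend_def hom_coalg_category hom_iff[of _ C] cofree_coalgebra coassoc)

lemma coextend_counit:
  assumes "a \<in> Obj C" "b \<in> Obj C" "f \<in> hom C (omap L a) b"
  shows "\<epsilon> b \<cdot>\<^bsub>C\<^esub> (amap L f \<cdot>\<^bsub>C\<^esub> \<Delta> a) = f"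
  using assms counit.naturality_reassoc[of f "omap L a" b "\<Delta> a"]
  by (simp add: counit_left hom_iff)

text \<open>The coalgebra equation for \<open>h\<close> and the right counit law recover
  \<open>h\<close> from its composite with \<epsilon>.\<close>

lemma coextend_corestrict:
  assumes "a \<in> Obj C" "b \<in> Obj C"
    and "(A, h, B) \<in> hom (coalg_category C L \<Delta> \<epsilon>) (omap L a, \<Delta> a) (omap L b, \<Delta> b)"
  shows "coextend a (\<epsilon> b \<cdot>\<^bsub>C\<^esub> h) b = (A, h, B)"
proof -
  have h: "h \<in> Arr C" "Dom C h = omap L a" "Cod C h = omap L b"
      "\<Delta> b \<cdot>\<^bsub>C\<^esub> h = amap L h \<cdot>\<^bsub>C\<^esub> \<Delta> a"
    and AB: "A = (omap L a, \<Delta> a)" "B = (omap L b, \<Delta> b)"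
    using assms(3) by (simp_all add: hom_coalg_category hom_iff[of _ C])
  have "amap L (\<epsilon> b \<cdot>\<^bsub>C\<^esub> h) \<cdot>\<^bsub>C\<^esub> \<Delta> a = amap L (\<epsilon> b) \<cdot>\<^bsub>C\<^esub> (\<Delta> b \<cdot>\<^bsub>C\<^esub> h)"
    using assms(1,2) h by simp
  also have "\<dots> = (amap L (\<epsilon> b) \<cdot>\<^bsub>C\<^esub> \<Delta> b) \<cdot>\<^bsub>C\<^esub> h"
    using assms(1,2) h(1-3) by simp
  finally show ?thesis
    using assms(1,2) h by (simp add: coextend_def counit_right AB)
qed

end


section \<open>Transposition between coKleisli and Kleisli composition\<close>

section \<open>The monad corresponding to a comonad with a right adjoint\<close>

locale comonad_right_adjoint =
  adj: adjunction C C L R \<eta> \<theta> + com: comonad C L \<Delta> \<epsilon>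
  for C :: "('o, 'm) category" (structure)
    and L R :: "('o, 'm, 'o, 'm) func" and \<eta> \<theta> \<Delta> \<epsilon> :: "'o \<Rightarrow> 'm" +
  fixes \<mu> \<iota> :: "'o \<Rightarrow> 'm"
  assumes corresponding: "corresponding_monad C L R \<eta> \<theta> \<Delta> \<epsilon> \<mu> \<iota>"
begin

lemma unit_eq: "x \<in> Obj C \<Longrightarrow> \<iota> x = amap R (\<epsilon> x) \<cdot> \<eta> x"
  using corresponding by (simp add: corresponding_monad_def nat_eq_def mate_def)

text \<open>Written this way, \<mu> is the transpose of the coKleisli composite of two counits
  \<theta>, which are themselves transposes of identities.\<close>

lemma mult_eq:
  "x \<in> Obj C \<Longrightarrow> \<mu> x = amap R (\<theta> x \<cdot> (amap L (\<theta> (omap R x)) \<cdot> \<Delta> (omap R (omap R x))))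
    \<cdot> \<eta> (omap R (omap R x))"
  using corresponding
  by (simp add: corresponding_monad_def nat_eq_def mate_def comp_counit_def)

lemma unit_Arr [simp]: "x \<in> Obj C \<Longrightarrow> \<iota> x \<in> Arr C"
  and Dom_unit [simp]: "x \<in> Obj C \<Longrightarrow> Dom C (\<iota> x) = x"
  and Cod_unit [simp]: "x \<in> Obj C \<Longrightarrow> Cod C (\<iota> x) = omap R x"
  by (simp_all add: unit_eq)

lemma mult_Arr [simp]: "x \<in> Obj C \<Longrightarrow> \<mu> x \<in> Arr C"
  and Dom_mult [simp]: "x \<in> Obj C \<Longrightarrow> Dom C (\<mu> x) = omap R (omap R x)"
  and Cod_mult [simp]: "x \<in> Obj C \<Longrightarrow> Cod C (\<mu> x) = omap R x"
  by (simp_all add: mult_eq)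

text \<open>Transposition carries coKleisli composition for the comonad to Kleisli composition for the
  corresponding monad, so every monad law is the transpose of a comonad law.\<close>

lemma transpose_coKleisli:
  assumes f: "f \<in> hom C (omap L a) b" and g: "g \<in> hom C (omap L b) c"
    and ob: "a \<in> Obj C" "b \<in> Obj C"
  shows "amap R (g \<cdot> (amap L f \<cdot> \<Delta> a)) \<cdot> \<eta> a
    = \<mu> c \<cdot> (amap R (amap R g \<cdot> \<eta> b) \<cdot> (amap R f \<cdot> \<eta> a))"
proof -
  define p where "p = amap R f \<cdot> \<eta> a"
  define q where "q = amap R g \<cdot> \<eta> b"
  define r where "r = amap R q \<cdot> p"
  have c: "c \<in> Obj C" using g by (auto simp: hom_iff)
  have p: "p \<in> Arr C" "Dom C p = a" "Cod C p = omap R b"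
    and q: "q \<in> Arr C" "Dom C q = b" "Cod C q = omap R c"
    using f g ob by (auto simp: hom_iff p_def q_def)
  have r: "r \<in> Arr C" "Dom C r = a" "Cod C r = omap R (omap R c)"
    using p q by (auto simp: r_def)
  have fp: "\<theta> b \<cdot> amap L p = f" and gq: "\<theta> c \<cdot> amap L q = g"
    using f g ob by (auto simp: hom_iff p_def q_def adj.unit_transpose)
  \<comment> \<open>Naturality of \<theta> at \<open>q\<close> moves \<theta> past \<open>q\<close>,
    and then \<open>fp\<close> applies.\<close>
  have r_q: "\<theta> (omap R c) \<cdot> amap L r = q \<cdot> f"
    using p q ob c adj.counit.naturality_reassoc[of q b "omap R c" "amap L p"]
    by (simp add: r_def fp)
  \<comment> \<open>After unfolding \<mu>, \<open>r\<close> slides past \<eta> and \<Delta> by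
    naturality until it meets the counits, which turn it back into \<open>g\<close> and
    \<open>f\<close>.\<close>
  have "\<mu> c \<cdot> r = amap R (\<theta> c \<cdot> (amap L (\<theta> (omap R c)) \<cdot> \<Delta> (omap R (omap R c))))
      \<cdot> (amap R (amap L r) \<cdot> \<eta> a)"
    using r c ob adj.unit.naturality[of r a "omap R (omap R c)"] by (simp add: mult_eq)
  also have "\<dots> = amap R (\<theta> c \<cdot> (amap L (\<theta> (omap R c)) \<cdot> (\<Delta> (omap R (omap R c)) \<cdot> amap L r)))
      \<cdot> \<eta> a"
    using r c ob by simp
  also have "\<Delta> (omap R (omap R c)) \<cdot> amap L r = amap L (amap L r) \<cdot> \<Delta> a"
    using r c ob com.comult.naturality[of r a] by simp
  also have "amap L (\<theta> (omap R c)) \<cdot> (amap L (amap L r) \<cdot> \<Delta> a)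
      = amap L (\<theta> (omap R c) \<cdot> amap L r) \<cdot> \<Delta> a"
    using r c ob by simp
  also have "\<theta> c \<cdot> (amap L (\<theta> (omap R c) \<cdot> amap L r) \<cdot> \<Delta> a)
      = (\<theta> c \<cdot> amap L q) \<cdot> (amap L f \<cdot> \<Delta> a)"
    unfolding r_q using p q c ob f by (simp add: hom_iff)
  finally show ?thesis unfolding gq by (simp add: r_def p_def q_def)
qed

section \<open>Monad laws as transposes of comonad laws\<close>

lemma mult_unit_left:
  assumes "x \<in> Obj C"
  shows "\<mu> x \<cdot> \<iota> (omap R x) = Id C (omap R x)"
  \<comment> \<open>\<epsilon> transposes to \<iota> and \<theta> to the identity; the coKleisli
    composite is \<theta> by the right counit law.\<close>
  using assms transpose_coKleisli[of "\<epsilon> (omap R x)" "omap R x" "omap R x" "\<theta> x" x]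
  by (simp add: hom_iff adj.triangle_right com.counit_right unit_eq)

lemma mult_unit_right:
  assumes "x \<in> Obj C"
  shows "\<mu> x \<cdot> amap R (\<iota> x) = Id C (omap R x)"
proof -
  have "\<epsilon> x \<cdot> (amap L (\<theta> x) \<cdot> \<Delta> (omap R x)) = \<theta> x"
    using assms com.coextend_counit[of "omap R x" x "\<theta> x"] by (simp add: hom_iff)
  then show ?thesis
    using assms transpose_coKleisli[of "\<theta> x" "omap R x" x "\<epsilon> x" x]
    by (simp add: hom_iff adj.triangle_right unit_eq)
qed

text \<open>Postcomposing the coKleisli composite that defines \<mu> with \<open>f\<close>
  postcomposes its transpose with \<open>amap R f\<close>.\<close>

lemma mult_natural:
  assumes "f \<in> hom C x y"
  shows "\<mu> y \<cdot> amap R (amap R f) = amap R f \<cdot> \<mu> x"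
proof -
  have "x \<in> Obj C" "y \<in> Obj C" using assms by (auto simp: hom_iff)
  then show ?thesis
    using assms transpose_coKleisli[of "\<theta> (omap R x)" "omap R (omap R x)" "omap R x" "f \<cdot> \<theta> x" y]
    by (simp add: hom_iff adj.triangle_right mult_eq[of x])
qed

lemma unit_natural:
  assumes "f \<in> hom C x y"
  shows "\<iota> y \<cdot> f = amap R f \<cdot> \<iota> x"
proof -
  have f: "x \<in> Obj C" "y \<in> Obj C" "f \<in> Arr C" "Dom C f = x" "Cod C f = y"
    using assms by (auto simp: hom_iff)
  have "\<iota> y \<cdot> f = amap R (\<epsilon> y \<cdot> amap L f) \<cdot> \<eta> x"
    using f adj.unit.naturality[of f x y] by (simp add: unit_eq)
  then show ?thesis using f com.counit.naturality[of f x y] by (simp add: unit_eq)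
qed

lemma mult_assoc:
  assumes "x \<in> Obj C"
  shows "\<mu> x \<cdot> \<mu> (omap R x) = \<mu> x \<cdot> amap R (\<mu> x)"
proof -
  let ?y = "omap R x" let ?z = "omap R ?y" let ?w = "omap R ?z"
  \<comment> \<open>\<open>m\<close> and \<open>n\<close> are the coKleisli composites whose
    transposes are the two instances of \<mu> in the law.\<close>
  define m where "m = \<theta> x \<cdot> (amap L (\<theta> ?y) \<cdot> \<Delta> ?z)"
  define n where "n = \<theta> ?y \<cdot> (amap L (\<theta> ?z) \<cdot> \<Delta> ?w)"
  have mn: "m \<in> hom C (omap L ?z) x" "n \<in> hom C (omap L ?w) ?y"
    using assms by (auto simp: m_def n_def hom_iff)
  have m: "amap R m \<cdot> \<eta> ?z = \<mu> x" and n: "amap R n \<cdot> \<eta> ?w = \<mu> ?y"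
    using assms by (simp_all add: mult_eq m_def n_def)
  \<comment> \<open>Associativity of coKleisli composition for three counits; transposing both
    bracketings gives the two sides.\<close>
  have "m \<cdot> (amap L (\<theta> ?z) \<cdot> \<Delta> ?w) = \<theta> x \<cdot> (amap L n \<cdot> \<Delta> ?w)"
    using assms com.comult.naturality_reassoc[of "\<theta> ?z" "omap L ?w" ?z "\<Delta> ?w"]
    by (simp add: m_def n_def com.coassoc)
  then have "\<mu> x \<cdot> (amap R (amap R m \<cdot> \<eta> ?z) \<cdot> (amap R (\<theta> ?z) \<cdot> \<eta> ?w))
      = \<mu> x \<cdot> (amap R (amap R (\<theta> x) \<cdot> \<eta> ?y) \<cdot> (amap R n \<cdot> \<eta> ?w))"
    using transpose_coKleisli[of "\<theta> ?z" ?w ?z m x] transpose_coKleisli[of n ?w ?y "\<theta> x" x]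
      assms mn by (simp only: hom_iff) simp
  then show ?thesis unfolding m n using assms by (simp add: adj.triangle_right)
qed

sublocale monad C R \<mu> \<iota>
  by unfold_locales
    (auto simp: hom_iff mult_natural unit_natural mult_unit_left mult_unit_right mult_assoc)

section \<open>Homomorphisms of cofree coalgebras and of free algebras\<close>

lemma heavily_separable_cofree_func_iff_free_func:
  "heavily_separable C (coalg_category C L \<Delta> \<epsilon>) (cofree_func C L \<Delta>) \<longleftrightarrow>
    heavily_separable C (alg_category C R \<mu> \<iota>) (free_func C R \<mu>)"
  (is "heavily_separable C ?D ?F \<longleftrightarrow> heavily_separable C ?E ?H")
proof -
  \<comment> \<open>Three bijections in a row: compose with \<epsilon> to get a coKleisli arrow,
    transpose it to a Kleisli arrow, extend. \<open>\<Xi>\<close> undoes them in reverse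
    order.\<close>
  define \<Psi> where "\<Psi> a b = (\<lambda>(A :: 'o \<times> 'm, h, B :: 'o \<times> 'm).
    extend a (amap R (\<epsilon> b \<cdot> h) \<cdot> \<eta> a) b)" for a b
  define \<Xi> where "\<Xi> a b = (\<lambda>(A :: 'o \<times> 'm, k, B :: 'o \<times> 'm).
    com.coextend a (\<theta> b \<cdot> amap L (k \<cdot> \<iota> a)) b)" for a b
  have omap: "omap ?F x = (omap L x, \<Delta> x)" "omap ?H x = (omap R x, \<mu> x)" for x
    by (simp_all add: cofree_func_def free_func_def)
  have coalg: "h \<in> Arr C" "Dom C h = omap L a" "Cod C h = omap L b" "com.coextend a (\<epsilon> b \<cdot> h) b = (A, h, B)"
    if "(A, h, B) \<in> hom ?D (omap ?F a) (omap ?F b)" "a \<in> Obj C" "b \<in> Obj C" for a b A h B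
    using that com.coextend_corestrict[of a b A h B]
    by (auto simp: omap hom_coalg_category hom_iff[of _ C])
  have alg: "k \<in> Arr C" "Dom C k = omap R a" "Cod C k = omap R b" "extend a (k \<cdot> \<iota> a) b = (A, k, B)"
    if "(A, k, B) \<in> hom ?E (omap ?H a) (omap ?H b)" "a \<in> Obj C" "b \<in> Obj C" for a b A k B
    using that extend_restrict[of a b A k B]
    by (auto simp: omap hom_alg_category hom_iff[of _ C])
  have bij: "bij_betw (\<Psi> a b) (hom ?D (omap ?F a) (omap ?F b)) (hom ?E (omap ?H a) (omap ?H b))"
    if ab: "a \<in> Obj C" "b \<in> Obj C" for a b
  proof (rule bij_betw_byWitness[where f' = "\<Xi> a b"])
    have "\<Xi> a b (\<Psi> a b (A, h, B)) = (A, h, B)" if "(A, h, B) \<in> hom ?D (omap ?F a) (omap ?F b)" for A h B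
    proof -
      note h = coalg[OF that ab]
      let ?p = "amap R (\<epsilon> b \<cdot> h) \<cdot> \<eta> a"
      have "\<Xi> a b (\<Psi> a b (A, h, B)) = com.coextend a (\<theta> b \<cdot> amap L ((\<mu> b \<cdot> amap R ?p) \<cdot> \<iota> a)) b"
        by (simp only: \<Psi>_def \<Xi>_def extend_def prod.case)
      also have "(\<mu> b \<cdot> amap R ?p) \<cdot> \<iota> a = ?p"
        using h(1-3) ab by (intro extend_unit) (simp_all add: hom_iff)
      also have "\<theta> b \<cdot> amap L ?p = \<epsilon> b \<cdot> h"
        using h(1-3) ab adj.unit_transpose[of a "\<epsilon> b \<cdot> h" b] by simp
      finally show ?thesis using h by simp
    qed
    then show "\<forall>h\<in>hom ?D (omap ?F a) (omap ?F b). \<Xi> a b (\<Psi> a b h) = h" by auto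
    have "\<Psi> a b (\<Xi> a b (A, k, B)) = (A, k, B)" if "(A, k, B) \<in> hom ?E (omap ?H a) (omap ?H b)" for A k B
    proof -
      note k = alg[OF that ab]
      let ?f = "\<theta> b \<cdot> amap L (k \<cdot> \<iota> a)"
      have "\<Psi> a b (\<Xi> a b (A, k, B)) = extend a (amap R (\<epsilon> b \<cdot> (amap L ?f \<cdot> \<Delta> a)) \<cdot> \<eta> a) b"
        by (simp only: \<Psi>_def \<Xi>_def com.coextend_def prod.case)
      also have "\<epsilon> b \<cdot> (amap L ?f \<cdot> \<Delta> a) = ?f"
        using k(1-3) ab by (intro com.coextend_counit) (simp_all add: hom_iff)
      also have "amap R ?f \<cdot> \<eta> a = k \<cdot> \<iota> a"
        using k(1-3) ab adj.counit_transpose[of b "k \<cdot> \<iota> a" a] by simp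
      finally show ?thesis using k by simp
    qed
    then show "\<forall>k\<in>hom ?E (omap ?H a) (omap ?H b). \<Psi> a b (\<Xi> a b k) = k" by auto
    show "\<Psi> a b ` hom ?D (omap ?F a) (omap ?F b) \<subseteq> hom ?E (omap ?H a) (omap ?H b)"
      using ab by (auto simp: \<Psi>_def omap(2) hom_iff[of _ C] coalg(1-3) intro!: extend_in)
    show "\<Xi> a b ` hom ?E (omap ?H a) (omap ?H b) \<subseteq> hom ?D (omap ?F a) (omap ?F b)"
      using ab by (auto simp: \<Xi>_def omap(1) hom_iff[of _ C] alg(1-3) intro!: com.coextend_in)
  qed
  show ?thesis
  proof (rule heavily_separable_transfer[where \<Psi> = \<Psi>, symmetric])
    show "cat_functor C ?E ?H" by (fact cat_functor_free_func)
    show "cat_functor C ?D ?F" by (fact com.cat_functor_cofree_func)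
    show "bij_betw (\<Psi> a b) (hom ?D (omap ?F a) (omap ?F b)) (hom ?E (omap ?H a) (omap ?H b))"
      if "a \<in> Obj C" "b \<in> Obj C" for a b
      using that by (fact bij)
    show "\<Psi> a b (amap ?F f) = amap ?H f" if "a \<in> Obj C" "b \<in> Obj C" "f \<in> hom C a b" for a b f
    proof -
      \<comment> \<open>Naturality of \<epsilon> brings the transpose into the form that
        \<open>extend_amap\<close> accepts.\<close>
      have "amap R (\<epsilon> b \<cdot> amap L f) \<cdot> \<eta> a = amap R f \<cdot> \<iota> a"
        using that com.counit.naturality[of f a b] by (simp add: unit_eq hom_iff)
      then show ?thesis
        using extend_amap[OF that(3)] by (simp add: \<Psi>_def cofree_func_def)
    qed
    show "\<Psi> a c (g \<cdot>\<^bsub>?D\<^esub> f) = \<Psi> b c g \<cdot>\<^bsub>?E\<^esub> \<Psi> a b f"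
      if ob: "a \<in> Obj C" "b \<in> Obj C" "c \<in> Obj C"
        and hs: "f \<in> hom ?D (omap ?F a) (omap ?F b)" "g \<in> hom ?D (omap ?F b) (omap ?F c)"
      for a b c f g
    proof -
      obtain A h B B' k B'' where fg: "f = (A, h, B)" "g = (B', k, B'')"
        by (cases f, cases g) auto
      note h = coalg[OF hs(1)[unfolded fg] ob(1,2)] and k = coalg[OF hs(2)[unfolded fg] ob(2,3)]
      \<comment> \<open>Since \<open>h\<close> is the coextension of its composite with \<epsilon>,
        the composite on the left is a coKleisli composite and \<open>transpose_coKleisli\<close>
        applies.\<close>
      have "amap R (\<epsilon> c \<cdot> (k \<cdot> h)) \<cdot> \<eta> a
          = amap R ((\<epsilon> c \<cdot> k) \<cdot> (amap L (\<epsilon> b \<cdot> h) \<cdot> \<Delta> a)) \<cdot> \<eta> a"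
        using h k ob by (simp add: com.coextend_def)
      also have "\<dots> = \<mu> c \<cdot> (amap R (amap R (\<epsilon> c \<cdot> k) \<cdot> \<eta> b) \<cdot> (amap R (\<epsilon> b \<cdot> h) \<cdot> \<eta> a))"
        using h(1-3) k(1-3) ob by (intro transpose_coKleisli) (simp_all add: hom_iff)
      finally have "\<Psi> a c (g \<cdot>\<^bsub>?D\<^esub> f) = extend a (\<mu> c \<cdot> (amap R (amap R (\<epsilon> c \<cdot> k) \<cdot> \<eta> b)
          \<cdot> (amap R (\<epsilon> b \<cdot> h) \<cdot> \<eta> a))) c"
        by (simp only: \<Psi>_def fg Comp_coalg_category prod.case)
      also have "\<dots> = \<Psi> b c g \<cdot>\<^bsub>?E\<^esub> \<Psi> a b f"
        unfolding \<Psi>_def fg prod.case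
        using h(1-3) k(1-3) ob by (intro extend_Comp) (simp_all add: hom_iff)
      finally show ?thesis .
    qed
  qed
qed

end


section \<open>The equivalences for Eilenberg-Moore functors and for adjoint endofunctors\<close>

theorem corollary4p4:
  fixes C :: "('o, 'm) category"
    and L R :: "('o, 'm, 'o, 'm) func"
    and \<eta> \<theta> \<Delta> \<epsilon> \<mu> \<iota> :: "'o \<Rightarrow> 'm"
  assumes "adjunction C C L R \<eta> \<theta>"
    and "comonad C L \<Delta> \<epsilon>"
    and "corresponding_monad C L R \<eta> \<theta> \<Delta> \<epsilon> \<mu> \<iota>"
  shows "(heavily_separable C (coalg_category C L \<Delta> \<epsilon>) (cofree_func C L \<Delta>) \<longleftrightarrow>
          heavily_separable C (alg_category C R \<mu> \<iota>) (free_func C R \<mu>)) \<and>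
    (\<forall>P Q :: ('o, 'm, 'o, 'm) func. \<forall>u c :: 'o \<Rightarrow> 'm.
       adjunction C C P Q u c \<and>
       associated_comonad C P Q u c L \<Delta> \<epsilon> \<and>
       associated_monad C P Q u c R \<mu> \<iota> \<longrightarrow>
       (heavily_separable C C Q \<longleftrightarrow> heavily_separable C C P))"
proof (intro conjI allI impI)
  interpret comonad_right_adjoint C L R \<eta> \<theta> \<Delta> \<epsilon> \<mu> \<iota>
    using assms by (simp add: comonad_right_adjoint_def comonad_right_adjoint_axioms_def)
  note iff = heavily_separable_cofree_func_iff_free_func
  show "heavily_separable C (coalg_category C L \<Delta> \<epsilon>) (cofree_func C L \<Delta>) \<longleftrightarrow>
      heavily_separable C (alg_category C R \<mu> \<iota>) (free_func C R \<mu>)"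
    by (fact iff)
  fix P Q :: "('o, 'm, 'o, 'm) func" and u c :: "'o \<Rightarrow> 'm"
  assume PQ: "adjunction C C P Q u c \<and> associated_comonad C P Q u c L \<Delta> \<epsilon> \<and>
    associated_monad C P Q u c R \<mu> \<iota>"
  \<comment> \<open>A second adjunction beside that of \<open>L\<close> and \<open>R\<close>: its
    comparison functors link \<open>Q\<close> to the cofree and \<open>P\<close> to the free
    functor, and \<open>iff\<close> joins these two.\<close>
  then interpret PQ: adjunction C C P Q u c by blast
  show "heavily_separable C C Q \<longleftrightarrow> heavily_separable C C P"
    using PQ PQ.heavily_separable_right_iff_cofree_func[OF com.comonad_axioms]
      PQ.heavily_separable_left_iff_free_func[OF monad_axioms] iff by blast
qed

end
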